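(* Let $B_0=\emptyset,B_1,B_2,\ldots$ be an enumeration of a countable base of $\mathcal{N}$ (with $B_0=\emptyset$) and let $\pi:\mathcal{N}\to{\bf\Sigma}^0_1(\mathcal{N})$ be given by $\pi(a)=\bigcup_nB_{a(n)}$. Then $E_\pi\in{\bf\Pi}^1_1(\mathcal{N})$, the set $\pi^{-1}(\{\mathcal{N}\})$ is Wadge complete in ${\bf\Pi}^1_1(\mathcal{N})$, and the space ${\bf\Sigma}^0_1(\mathcal{N})$, equipped with either the Scott topology or the compact-open topology, is not countably based.
   Context: $\mathcal{N}=\omega^\omega$ is the Baire space and ${\bf\Sigma}^0_1(\mathcal{N})$ its set of open subsets. $\langle a,b\rangle\in\mathcal{N}$ denotes the sequence with $\langle a,b\rangle(2n)=a(n)$, $\langle a,b\rangle(2n+1)=b(n)$, and $E_\pi=\{\langle a,b\rangle\mid\pi(a)=\pi(b)\}\subseteq\mathcal{N}$. ${\bf\Pi}^1_1(\mathcal{N})$ is the class of coanalytic subsets of $\mathcal{N}$. A set $A$ is Wadge complete in ${\bf\Pi}^1_1(\mathcal{N})$ if $A\in{\bf\Pi}^1_1(\mathcal{N})$ and every $B\in{\bf\Pi}^1_1(\mathcal{N})$ satisfies $B=f^{-1}(A)$ for some continuous $f:\mathcal{N}\to\mathcal{N}$. The Scott topology on ${\bf\Sigma}^0_1(\mathcal{N})$ is that of the complete lattice $({\bf\Sigma}^0_1(\mathcal{N});\subseteq)$; the compact-open topology is generated by the sets $\{A\mid K\subseteq A\}$, $K\subseteq\mathcal{N}$ compact. *)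

theory Defs
  imports "HOL-Analysis.Analysis" "HOL-Library.Lub_Glb"
begin

text \<open>The product topology of \<open>nat \<Rightarrow> nat\<close>, with \<open>nat\<close> discrete, is that of the Baire space.\<close>

type_synonym baire = "nat \<Rightarrow> nat"

definition interleave :: "baire \<Rightarrow> baire \<Rightarrow> baire"
  where "interleave a b = (\<lambda>n. if even n then a (n div 2) else b (n div 2))"

lemma interleave_even [simp]: "interleave a b (2 * n) = a n"
  by (simp add: interleave_def)

lemma interleave_odd [simp]: "interleave a b (2 * n + 1) = b n"
  by (simp add: interleave_def)

definition kernel_code :: "(baire \<Rightarrow> 'a) \<Rightarrow> baire set"
  where "kernel_code p = {interleave a b |a b. p a = p b}"

text \<open>The pointclass \<open>\<Sigma>\<^sup>1\<^sub>1\<close> consists of the projections of closed sets along the Baire space.\<close>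

definition analytic_sets :: "'a::topological_space set set"
  where "analytic_sets = {fst ` F |F :: ('a \<times> baire) set. closed F}"

definition coanalytic_sets :: "'a::topological_space set set"
  where "coanalytic_sets = {A. - A \<in> analytic_sets}"

definition wadge_complete :: "baire set set \<Rightarrow> baire set \<Rightarrow> bool"
  where "wadge_complete \<Gamma> A \<longleftrightarrow>
    A \<in> \<Gamma> \<and> (\<forall>B\<in>\<Gamma>. \<exists>f :: baire \<Rightarrow> baire. continuous_on UNIV f \<and> B = f -` A)"

definition directed_set :: "'a::order set \<Rightarrow> bool"
  where "directed_set D \<longleftrightarrow> D \<noteq> {} \<and> (\<forall>x\<in>D. \<forall>y\<in>D. \<exists>z\<in>D. x \<le> z \<and> y \<le> z)"

text \<open>Scott openness in the poset \<open>L\<close> with the induced order; suprema are taken in \<open>L\<close>.\<close>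

definition scott_open :: "'a::order set \<Rightarrow> 'a set \<Rightarrow> bool"
  where "scott_open L U \<longleftrightarrow> U \<subseteq> L \<and>
    (\<forall>x\<in>U. \<forall>y\<in>L. x \<le> y \<longrightarrow> y \<in> U) \<and>
    (\<forall>D s. D \<subseteq> L \<longrightarrow> directed_set D \<longrightarrow> isLub L D s \<longrightarrow> s \<in> U \<longrightarrow> D \<inter> U \<noteq> {})"

definition scott_topology :: "'a::order set \<Rightarrow> 'a topology"
  where "scott_topology L = topology (scott_open L)"

lemma istopology_scott_open: "istopology (scott_open L)"
  unfolding istopology_def
proof (intro conjI allI impI)
  fix U V assume U: "scott_open L U" and V: "scott_open L V"
  show "scott_open L (U \<inter> V)"
    unfolding scott_open_def
  proof (intro conjI allI impI)
    show "U \<inter> V \<subseteq> L" "\<forall>x\<in>U \<inter> V. \<forall>y\<in>L. x \<le> y \<longrightarrow> y \<in> U \<inter> V"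
      using U V by (auto simp: scott_open_def)
  next
    fix D s assume D: "D \<subseteq> L" "directed_set D" "isLub L D s" "s \<in> U \<inter> V"
    have "D \<inter> U \<noteq> {}" "D \<inter> V \<noteq> {}"
      using U V D by (simp_all add: scott_open_def)
    then obtain u v where u: "u \<in> D" "u \<in> U" and v: "v \<in> D" "v \<in> V" by blast
    obtain z where z: "z \<in> D" "u \<le> z" "v \<le> z"
      using D(2) u v unfolding directed_set_def by blast
    then have "z \<in> L" using D(1) by blast
    then have "z \<in> U" "z \<in> V"
      using U V u v z unfolding scott_open_def by simp_all
    with z show "D \<inter> (U \<inter> V) \<noteq> {}" by blast
  qed
next
  fix \<K> assume K: "\<forall>K\<in>\<K>. scott_open L K"
  show "scott_open L (\<Union>\<K>)"
    unfolding scott_open_def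
  proof (intro conjI allI impI)
    have Kin: "U \<subseteq> L" and Kup: "\<And>x y. x \<in> U \<Longrightarrow> y \<in> L \<Longrightarrow> x \<le> y \<Longrightarrow> y \<in> U"
      if "U \<in> \<K>" for U
      using K that by (simp_all add: scott_open_def)
    show "\<Union>\<K> \<subseteq> L" "\<forall>x\<in>\<Union>\<K>. \<forall>y\<in>L. x \<le> y \<longrightarrow> y \<in> \<Union>\<K>"
      using Kin Kup by blast+
  next
    fix D s assume D: "D \<subseteq> L" "directed_set D" "isLub L D s" "s \<in> \<Union>\<K>"
    then obtain U where U: "U \<in> \<K>" "s \<in> U" by blast
    with K D have "D \<inter> U \<noteq> {}"
      by (simp add: scott_open_def)
    with U show "D \<inter> \<Union>\<K> \<noteq> {}" by blast
  qed
qed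

lemma openin_scott_topology: "openin (scott_topology L) U \<longleftrightarrow> scott_open L U"
  by (simp add: scott_topology_def topology_inverse' istopology_scott_open)

lemma topspace_scott_topology [simp]: "topspace (scott_topology L) = L"
proof (rule subset_antisym)
  show "topspace (scott_topology L) \<subseteq> L"
    using openin_topspace[of "scott_topology L"]
    by (simp only: openin_scott_topology scott_open_def)
  have "D \<inter> L \<noteq> {}" if "D \<subseteq> L" "directed_set D" for D
    using that by (auto simp: directed_set_def)
  then have "scott_open L L"
    by (simp add: scott_open_def)
  then have "openin (scott_topology L) L"
    by (simp only: openin_scott_topology)
  then show "L \<subseteq> topspace (scott_topology L)"
    by (rule openin_subset)
qed

definition open_sets :: "'a::topological_space set set"
  where "open_sets = {A. open A}"

definition compact_open_topology :: "'a::topological_space set topology"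
  where "compact_open_topology =
    topology_generated_by {{A \<in> open_sets. K \<subseteq> A} |K. compact K}"

lemma topspace_compact_open_topology [simp]:
  "topspace (compact_open_topology :: 'a::topological_space set topology) = open_sets"
  unfolding compact_open_topology_def topology_generated_by_topspace
proof (rule subset_antisym)
  have "open_sets = {A \<in> open_sets. {} \<subseteq> (A :: 'a set)}" by blast
  then have "(open_sets :: 'a set set) \<in> {{A \<in> open_sets. K \<subseteq> A} |K. compact K}"
    using compact_empty by blast
  then show "open_sets \<subseteq> \<Union>{{A \<in> open_sets. K \<subseteq> (A :: 'a set)} |K. compact K}"
    by (rule Union_upper)
qed blast

end

theory Submission
  imports Defs
begin

text \<open>The relation \<open>x \<in> \<pi> a\<close> is open in \<open>(a, x)\<close>, so \<open>\<pi> a \<noteq> \<pi> b\<close> and \<open>\<pi> a \<noteq> UNIV\<close> are projections of an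
  \<open>F\<^sub>\<sigma>\<close> set and of a closed set respectively. For completeness, a continuous \<open>f\<close> lists the basic open
  sets contained in the section at \<open>a\<close> of the complement of a closed set \<open>F\<close>: then \<open>\<pi> (f a)\<close> is that
  section, and it is the whole space iff \<open>a\<close> is not in the projection of \<open>F\<close>. In both topologies a
  neighbourhood of the whole space contains, for each coordinate, a set bounded in that coordinate, and a
  diagonal argument rules out a countable neighbourhood base there.\<close>

section \<open>Cylinders in the Baire space\<close>

definition cylinder :: "baire \<Rightarrow> nat \<Rightarrow> baire set"
  where "cylinder a k = {b. \<forall>i<k. b i = a i}"

lemma cylinder_refl [simp]: "a \<in> cylinder a k"
  by (simp add: cylinder_def)

lemma cylinder_eq: "b \<in> cylinder a k \<Longrightarrow> cylinder b k = cylinder a k"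
  by (auto simp: cylinder_def)

lemma open_coordinate: "open {x :: baire. P (x n)}"
proof -
  have "continuous_on UNIV (\<lambda>x :: baire. x n)"
    by simp
  then have "open ((\<lambda>x :: baire. x n) -` Collect P)"
    by (rule open_vimage[rotated]) (rule open_discrete)
  then show ?thesis
    by (simp add: vimage_def)
qed

lemma open_cylinder: "open (cylinder a k)"
proof -
  have "cylinder a k = (\<Inter>i\<in>{..<k}. {b. b i = a i})"
    by (auto simp: cylinder_def)
  moreover have "open (\<Inter>i\<in>{..<k}. {b :: baire. b i = a i})"
    by (intro open_INT ballI open_coordinate) auto
  ultimately show ?thesis
    by simp
qed

lemma open_contains_cylinder:
  assumes "open U" "a \<in> U"
  obtains k where "cylinder a k \<subseteq> U"
proof -
  have "openin (product_topology (\<lambda>_. euclidean) UNIV) U"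
    using assms(1) by (simp only: euclidean_product_topology open_openin)
  from product_topology_open_contains_basis[OF this assms(2)]
  obtain X where X: "a \<in> Pi\<^sub>E UNIV X" "finite {i. X i \<noteq> (UNIV :: nat set)}" "Pi\<^sub>E UNIV X \<subseteq> U"
    unfolding topspace_euclidean by blast
  then obtain k where k: "\<And>i. X i \<noteq> UNIV \<Longrightarrow> i < k"
    using finite_nat_set_iff_bounded[of "{i. X i \<noteq> UNIV}"] by auto
  have "cylinder a k \<subseteq> Pi\<^sub>E UNIV X"
  proof
    fix b assume "b \<in> cylinder a k"
    then have "b i \<in> X i" for i
      using X(1) k[of i] by (cases "X i = UNIV") (auto simp: cylinder_def PiE_iff)
    then show "b \<in> Pi\<^sub>E UNIV X"
      by auto
  qed
  then have "cylinder a k \<subseteq> U"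
    using X(3) by (rule subset_trans)
  then show ?thesis
    by (rule that)
qed

text \<open>The modulus \<open>k j\<close> depends on the output coordinate alone, so every preimage
  under a coordinate of \<open>f\<close> is a union of cylinders of one length.\<close>

lemma continuous_on_finite_dependence:
  fixes f :: "baire \<Rightarrow> baire"
  assumes "\<And>j a b. b \<in> cylinder a (k j) \<Longrightarrow> f b j = f a j"
  shows "continuous_on UNIV f"
proof (rule continuous_on_coordinatewise_then_product)
  fix j
  show "continuous_on UNIV (\<lambda>a. f a j)"
    unfolding continuous_on_open_vimage[OF open_UNIV]
  proof (intro allI impI)
    fix V :: "nat set"
    have "(\<lambda>a. f a j) -` V = (\<Union>a\<in>(\<lambda>a. f a j) -` V. cylinder a (k j))"
      using assms by fastforce
    moreover have "open (\<Union>a\<in>(\<lambda>a. f a j) -` V. cylinder a (k j))"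
      by (intro open_UN ballI open_cylinder)
    ultimately show "open ((\<lambda>a. f a j) -` V \<inter> UNIV)"
      by simp
  qed
qed

section \<open>F-sigma sets and their projections\<close>

lemma cylinder_antimono: "k \<le> l \<Longrightarrow> cylinder a l \<subseteq> cylinder a k"
  by (auto simp: cylinder_def)

text \<open>Sort the points of \<open>U\<close> by a length \<open>k\<close> for which the box of
  \<open>k\<close>-cylinders around them fits into \<open>U\<close>. Whether it fits is decided by
  the first \<open>k\<close> entries of both components, so each layer has an open
  complement.\<close>

lemma open_baire_prod_fsigma:
  fixes U :: "(baire \<times> baire) set"
  assumes "open U"
  shows "fsigma_in euclidean U"
proof -
  define C where "C k = {(a, x). cylinder a k \<times> cylinder x k \<subseteq> U}" for k
  have "closed (C k)" for k
  proof -
    have "(b, y) \<in> C k \<longleftrightarrow> (a, x) \<in> C k" if "b \<in> cylinder a k" "y \<in> cylinder x k" for a b x y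
      using that by (simp add: C_def cylinder_eq)
    then have "- C k = (\<Union>(a, x)\<in>- C k. cylinder a k \<times> cylinder x k)"
      by fastforce
    moreover have "open (\<Union>(a, x)\<in>- C k. cylinder a k \<times> cylinder x k)"
      by (auto intro!: open_UN open_Times open_cylinder)
    ultimately show ?thesis
      by (simp add: closed_def)
  qed
  then have "fsigma_in euclidean (\<Union>(range C))"
    by (intro fsigma_in_Union) (auto intro: closed_imp_fsigma_in)
  moreover have "\<Union>(range C) = U"
  proof
    show "\<Union>(range C) \<subseteq> U"
      using cylinder_refl by (force simp: C_def)
    show "U \<subseteq> \<Union>(range C)"
    proof clarify
      fix a x assume "(a, x) \<in> U"
      with assms obtain V W where VW: "open V" "open W" "(a, x) \<in> V \<times> W" "V \<times> W \<subseteq> U"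
        by (rule open_prod_elim)
      then have mem: "a \<in> V" "x \<in> W"
        by auto
      obtain k where k: "cylinder a k \<subseteq> V"
        using VW(1) mem(1) by (rule open_contains_cylinder)
      obtain l where l: "cylinder x l \<subseteq> W"
        using VW(2) mem(2) by (rule open_contains_cylinder)
      have "cylinder a (max k l) \<subseteq> V" "cylinder x (max k l) \<subseteq> W"
        using k l cylinder_antimono[of k "max k l" a] cylinder_antimono[of l "max k l" x] by auto
      then have "(a, x) \<in> C (max k l)"
        unfolding C_def using VW(4) by blast
      then show "(a, x) \<in> \<Union>(range C)"
        by blast
    qed
  qed
  ultimately show ?thesis
    by simp
qed

text \<open>\<open>analytic_sets\<close> allows only closed sets under the projection, but comparing
  two open sets yields an F-sigma set. The countable union is absorbed by lengthening the witness by
  one entry.\<close>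

lemma analytic_fsigma_projection:
  fixes S :: "('a::topological_space \<times> baire) set"
  assumes "fsigma_in euclidean S"
  shows "fst ` S \<in> analytic_sets"
proof -
  obtain C where C: "\<And>n::nat. closed (C n)" "S = (\<Union>n. C n)"
    using assms unfolding fsigma_in_ascending by auto
  define h :: "'a \<times> baire \<Rightarrow> 'a \<times> baire" where "h p = (fst p, \<lambda>i. snd p (Suc i))" for p
  have cont: "continuous_on UNIV h"
    unfolding h_def
    by (intro continuous_intros continuous_on_coordinatewise_then_product
        continuous_on_product_then_coordinatewise)
  define F where "F = {p. h p \<in> C (snd p 0)}"
  \<comment> \<open>The first entry of the witness selects the member of the union.\<close>
  have "F = - (\<Union>n. {p. snd p 0 = n} \<inter> h -` (- C n))"
    by (auto simp: F_def)
  moreover have "open ({p :: 'a \<times> baire. snd p 0 = n} \<inter> h -` (- C n))" for n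
  proof (rule open_Int)
    have "open (snd -` {x :: baire. x 0 = n} :: ('a \<times> baire) set)"
      by (intro open_vimage_snd open_coordinate)
    then show "open {p :: 'a \<times> baire. snd p 0 = n}"
      by (simp add: vimage_def)
    show "open (h -` (- C n))"
      using C(1) cont by (intro open_vimage) auto
  qed
  ultimately have "closed F"
    by (simp add: closed_def open_UN)
  moreover have "fst ` S = fst ` F"
  proof
    show "fst ` S \<subseteq> fst ` F"
    proof clarify
      fix a x assume "(a, x) \<in> S"
      then obtain n where "(a, x) \<in> C n"
        using C(2) by blast
      then have "(a, case_nat n x) \<in> F"
        by (simp add: F_def h_def)
      then show "fst (a, x) \<in> fst ` F"
        by force
    qed
    show "fst ` F \<subseteq> fst ` S"
      using C(2) by (force simp: F_def h_def)
  qed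
  ultimately show ?thesis
    unfolding analytic_sets_def by blast
qed

section \<open>Coanalyticity of the kernel\<close>

text \<open>The reindexing \<open>g\<close> lets one statement serve the even half, the odd half and
  the whole of a code.\<close>

lemma open_code_membership:
  fixes B :: "nat \<Rightarrow> baire set" and g :: "nat \<Rightarrow> nat"
  assumes "\<And>n. open (B n)"
  shows "open {(c :: baire, x). x \<in> (\<Union>n. B (c (g n)))}"
proof -
  have "{(c :: baire, x). x \<in> (\<Union>n. B (c (g n)))} = (\<Union>n m. {c. c (g n) = m} \<times> B m)"
    by auto
  also have "open \<dots>"
    by (intro open_UN ballI open_Times open_coordinate assms)
  finally show ?thesis .
qed

lemma mem_fst_image: "c \<in> fst ` R \<longleftrightarrow> (\<exists>x. (c, x) \<in> R)"
  by force

lemma fst_image_symmetric_difference: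
  "fst ` (({(c, x). x \<in> P c} - {(c, x). x \<in> Q c}) \<union> ({(c, x). x \<in> Q c} - {(c, x). x \<in> P c}))
    = {c. P c \<noteq> Q c}"
  by (rule set_eqI) (unfold mem_fst_image, simp add: set_eq_iff, blast)

lemma coanalytic_kernel_code:
  fixes B :: "nat \<Rightarrow> baire set"
  assumes B: "\<And>n. open (B n)"
    and p: "\<And>a. p a = (\<Union>n. B (a n))"
  shows "kernel_code p \<in> coanalytic_sets"
proof -
  \<comment> \<open>\<open>?E\<close> and \<open>?O\<close> are the membership relations of the sets
    coded by the two halves of \<open>c\<close>; a witness for inequality is a point in exactly one
    of them.\<close>
  let ?E = "{(c :: baire, x). x \<in> (\<Union>n. B (c (2 * n)))}"
  let ?O = "{(c :: baire, x). x \<in> (\<Union>n. B (c (2 * n + 1)))}"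
  have compl: "- kernel_code p = {c. p (\<lambda>n. c (2 * n)) \<noteq> p (\<lambda>n. c (2 * n + 1))}"
  proof -
    have "c \<in> kernel_code p \<longleftrightarrow> p (\<lambda>n. c (2 * n)) = p (\<lambda>n. c (2 * n + 1))" for c
    proof
      assume "c \<in> kernel_code p"
      then show "p (\<lambda>n. c (2 * n)) = p (\<lambda>n. c (2 * n + 1))"
        unfolding kernel_code_def by (clarsimp simp del: One_nat_def add_Suc_right)
    next
      assume "p (\<lambda>n. c (2 * n)) = p (\<lambda>n. c (2 * n + 1))"
      moreover have "c = interleave (\<lambda>n. c (2 * n)) (\<lambda>n. c (2 * n + 1))"
        by (auto simp: interleave_def fun_eq_iff)
      ultimately show "c \<in> kernel_code p"
        unfolding kernel_code_def by blast
    qed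
    then show ?thesis
      by blast
  qed
  have eq: "- kernel_code p = fst ` ((?E - ?O) \<union> (?O - ?E))"
    unfolding compl p fst_image_symmetric_difference ..
  have E: "open ?E"
    by (rule open_code_membership[of B "\<lambda>n. 2 * n"]) (rule B)
  have O: "open ?O"
    by (rule open_code_membership[of B "\<lambda>n. 2 * n + 1"]) (rule B)
  have fs: "fsigma_in euclidean (U - V)" if "open U" "open V" for U V :: "(baire \<times> baire) set"
  proof -
    have "fsigma_in euclidean (U \<inter> - V)"
    proof (rule fsigma_in_Int)
      show "fsigma_in euclidean U"
        using that(1) by (rule open_baire_prod_fsigma)
      show "fsigma_in euclidean (- V)"
        using that(2) by (intro closed_imp_fsigma_in) (simp add: closed_def)
    qed
    then show ?thesis
      by (simp add: Diff_eq)
  qed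
  show ?thesis
    unfolding coanalytic_sets_def mem_Collect_eq eq
    by (intro analytic_fsigma_projection fsigma_in_Un fs E O)
qed

section \<open>Wadge completeness of the codes of the whole space\<close>

lemma wadge_complete_code_UNIV:
  fixes B :: "nat \<Rightarrow> baire set"
  assumes base: "topological_basis (range B)" and B0: "B 0 = {}"
    and p: "\<And>a. p a = (\<Union>n. B (a n))"
  shows "wadge_complete coanalytic_sets (p -` {UNIV})"
  unfolding wadge_complete_def
proof (intro conjI ballI)
  have B: "open (B n)" for n
    using topological_basis_open[OF base] by blast
  let ?M = "{(c :: baire, x). x \<in> (\<Union>n. B (c n))}"
  have "closed (- ?M)"
    using open_code_membership[of B "\<lambda>n. n"] B by (simp add: closed_def)
  moreover have "- (p -` {UNIV}) = fst ` (- ?M)"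
  proof (rule set_eqI)
    fix c
    have "c \<in> - (p -` {UNIV}) \<longleftrightarrow> (\<exists>x. x \<notin> (\<Union>n. B (c n)))"
      unfolding p[symmetric] by auto
    then show "c \<in> - (p -` {UNIV}) \<longleftrightarrow> c \<in> fst ` (- ?M)"
      unfolding mem_fst_image by simp
  qed
  ultimately show "p -` {UNIV} \<in> coanalytic_sets"
    unfolding coanalytic_sets_def analytic_sets_def by blast
next
  fix A :: "baire set" assume "A \<in> coanalytic_sets"
  then obtain F :: "(baire \<times> baire) set" where F: "closed F" "- A = fst ` F"
    unfolding coanalytic_sets_def analytic_sets_def by blast
  \<comment> \<open>Each \<open>j\<close> codes a test: does the box of the
    \<open>k\<close>-cylinder of \<open>a\<close> and \<open>B n\<close> avoid \<open>F\<close>? A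
    failed test outputs 0, which adds nothing to the union because \<open>B 0\<close> is empty. The
    test reads only the first \<open>k\<close> entries of \<open>a\<close>, whence
    continuity.\<close>
  define f :: "baire \<Rightarrow> baire" where
    "f a j = (let (k, n) = prod_decode j in if cylinder a k \<times> B n \<subseteq> - F then n else 0)" for a j
  have "continuous_on UNIV f"
    by (rule continuous_on_finite_dependence[where k = "\<lambda>j. fst (prod_decode j)"])
      (simp add: f_def cylinder_eq prod.case_eq_if)
  moreover have pf: "p (f a) = {x. (a, x) \<notin> F}" for a
  proof
    show "p (f a) \<subseteq> {x. (a, x) \<notin> F}"
    proof
      fix x assume "x \<in> p (f a)"
      then obtain j where j: "x \<in> B (f a j)"
        unfolding p by blast
      obtain k n where kn: "prod_decode j = (k, n)"
        by (cases "prod_decode j")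
      have "cylinder a k \<times> B n \<subseteq> - F" "x \<in> B n"
        using j B0 by (auto simp: f_def kn split: if_splits)
      then show "x \<in> {x. (a, x) \<notin> F}"
        using cylinder_refl by blast
    qed
    show "{x. (a, x) \<notin> F} \<subseteq> p (f a)"
    proof clarify
      fix x assume "(a, x) \<notin> F"
      then have "(a, x) \<in> - F"
        by simp
      with F(1) obtain U V where UV: "open U" "open V" "(a, x) \<in> U \<times> V" "U \<times> V \<subseteq> - F"
        unfolding closed_def by (rule open_prod_elim)
      then have mem: "a \<in> U" "x \<in> V"
        by auto
      obtain k where k: "cylinder a k \<subseteq> U"
        using UV(1) mem(1) by (rule open_contains_cylinder)
      obtain n where n: "x \<in> B n" "B n \<subseteq> V"
        using topological_basisE[OF base UV(2) mem(2)] by blast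
      have "cylinder a k \<times> B n \<subseteq> - F"
        using k n(2) UV(4) by blast
      then have "f a (prod_encode (k, n)) = n"
        by (simp add: f_def)
      then show "x \<in> p (f a)"
        unfolding p using n(1) by (intro UN_I[of "prod_encode (k, n)"]) simp_all
    qed
  qed
  moreover have "A = f -` (p -` {UNIV})"
  proof -
    have "a \<in> A \<longleftrightarrow> (\<forall>x. (a, x) \<notin> F)" for a
      using F(2) mem_fst_image[of a F] by blast
    then show ?thesis
      by (auto simp: pf set_eq_iff)
  qed
  ultimately show "\<exists>f :: baire \<Rightarrow> baire. continuous_on UNIV f \<and> A = f -` (p -` {UNIV})"
    by blast
qed

section \<open>Failure of second countability\<close>

text \<open>Unions of open sets are open, so suprema in the lattice of open sets are plain unions.
  This direction shows that the open sets containing a given point form a Scott open family.\<close>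

lemma isLub_open_sets:
  assumes "D \<subseteq> open_sets" "isLub open_sets D s"
  shows "s = \<Union>D"
proof
  have "\<Union>D \<in> open_sets"
    using assms(1) by (auto simp: open_sets_def)
  then have "isUb open_sets D (\<Union>D)"
    by (auto simp: isUb_def setle_def)
  then show "s \<subseteq> \<Union>D"
    using assms(2) by (rule isLub_le_isUb[rotated])
  show "\<Union>D \<subseteq> s"
    using isLubD1[OF assms(2)] by (auto simp: setle_def)
qed

lemma isLub_Union_open_sets:
  assumes "D \<subseteq> open_sets"
  shows "isLub open_sets D (\<Union>D)"
proof (rule isLubI2)
  have "\<Union>D \<in> open_sets"
    using assms by (auto simp: open_sets_def)
  then show "isUb open_sets D (\<Union>D)"
    by (auto simp: isUb_def setle_def)
  show "\<Union>D <=* Collect (isUb open_sets D)"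
    by (auto simp: setge_def isUb_def setle_def)
qed

text \<open>Diagonalisation: given neighbourhoods \<open>U\<^sub>n\<close> of the whole space, choose in \<open>U\<^sub>n\<close> a set bounded
  in the \<open>n\<close>-th coordinate; the point exceeding every one of these bounds yields a neighbourhood containing no \<open>U\<^sub>n\<close>.\<close>

lemma not_second_countable_open_sets:
  fixes T :: "baire set topology"
  assumes point: "\<And>x. openin T {A \<in> open_sets. x \<in> A}"
    and bounded: "\<And>U n. openin T U \<Longrightarrow> UNIV \<in> U \<Longrightarrow> \<exists>j. {x. x n \<le> j} \<in> U"
  shows "\<not> second_countable T"
proof
  assume "second_countable T"
  then obtain \<B> where \<B>: "countable \<B>" "\<And>V. V \<in> \<B> \<Longrightarrow> openin T V"
    "\<And>U A. openin T U \<Longrightarrow> A \<in> U \<Longrightarrow> \<exists>V\<in>\<B>. A \<in> V \<and> V \<subseteq> U"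
    unfolding second_countable_def by metis
  \<comment> \<open>Distinct members of the base get distinct coordinates, so a single point can
    exceed all their bounds independently.\<close>
  let ?n = "to_nat_on \<B>"
  have "\<exists>j. V \<in> \<B> \<longrightarrow> UNIV \<in> V \<longrightarrow> {x. x (?n V) \<le> j} \<in> V" for V
    using bounded \<B>(2) by blast
  then obtain j where j: "\<And>V. V \<in> \<B> \<Longrightarrow> UNIV \<in> V \<Longrightarrow> {x. x (?n V) \<le> j V} \<in> V"
    by metis
  \<comment> \<open>\<open>Suc\<close> pushes \<open>x\<close> strictly beyond the bound in the
    coordinate belonging to each member of the base.\<close>
  define x where "x n = Suc (j (from_nat_into \<B> n))" for n
  have x: "x (?n V) = Suc (j V)" if "V \<in> \<B>" for V
    using that \<B>(1) by (simp add: x_def)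
  have "UNIV \<in> {A \<in> open_sets. x \<in> A}"
    by (simp add: open_sets_def)
  with \<B>(3) point obtain V where V: "V \<in> \<B>" "UNIV \<in> V" "V \<subseteq> {A \<in> open_sets. x \<in> A}"
    by blast
  with j have "x \<in> {x. x (?n V) \<le> j V}"
    by blast
  with x[OF V(1)] show False
    by simp
qed

lemma not_second_countable_scott_topology:
  "\<not> second_countable (scott_topology (open_sets :: baire set set))"
proof (rule not_second_countable_open_sets)
  fix x :: baire
  show "openin (scott_topology open_sets) {A \<in> open_sets. x \<in> A}"
    unfolding openin_scott_topology scott_open_def
    using isLub_open_sets by blast
next
  fix U :: "baire set set" and n
  assume U: "openin (scott_topology open_sets) U" "UNIV \<in> U"
  \<comment> \<open>An increasing chain of open sets exhausting the whole space: a Scott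
    neighbourhood of its supremum must contain one of its members.\<close>
  let ?D = "range (\<lambda>j. {x :: baire. x n \<le> j})"
  have D: "?D \<subseteq> open_sets"
    using open_coordinate by (auto simp: open_sets_def)
  have "directed_set ?D"
    unfolding directed_set_def
  proof (intro conjI ballI)
    fix X Y assume "X \<in> ?D" "Y \<in> ?D"
    then obtain i j where "X = {x. x n \<le> i}" "Y = {x. x n \<le> j}"
      by blast
    then show "\<exists>Z\<in>?D. X \<le> Z \<and> Y \<le> Z"
      by (intro bexI[of _ "{x. x n \<le> max i j}"]) auto
  qed simp
  moreover have "isLub open_sets ?D UNIV"
  proof -
    have "\<Union>?D = UNIV"
      by auto
    with isLub_Union_open_sets[OF D] show ?thesis
      by simp
  qed
  ultimately have "?D \<inter> U \<noteq> {}"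
    using U D unfolding openin_scott_topology scott_open_def by blast
  then show "\<exists>j. {x. x n \<le> j} \<in> U"
    by blast
qed

text \<open>The generating sets, a priori only a subbase, behave as a base: containing
  \<open>K1\<close> and containing \<open>K2\<close> amounts to containing the compact set
  \<open>K1 \<union> K2\<close>.\<close>

lemma compact_open_neighbourhood:
  assumes "openin compact_open_topology U" "A \<in> U"
  obtains K where "compact K" "K \<subseteq> A" "{V \<in> open_sets. K \<subseteq> V} \<subseteq> U"
proof -
  have "generate_topology_on {{A \<in> open_sets. K \<subseteq> A} |K. compact K} U"
    using assms(1) by (simp add: compact_open_topology_def openin_topology_generated_by_iff)
  then have "\<exists>K. compact K \<and> K \<subseteq> A \<and> {V \<in> open_sets. K \<subseteq> V} \<subseteq> U"
    using assms(2)
  proof induction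
    case (Int U1 U2)
    then obtain K1 K2 where "compact K1" "K1 \<subseteq> A" "{V \<in> open_sets. K1 \<subseteq> V} \<subseteq> U1"
      "compact K2" "K2 \<subseteq> A" "{V \<in> open_sets. K2 \<subseteq> V} \<subseteq> U2"
      by blast
    then show ?case
      by (intro exI[of _ "K1 \<union> K2"]) (auto intro: compact_Un)
  next
    case (UN \<U>)
    then obtain U where U: "U \<in> \<U>" "A \<in> U"
      by blast
    then obtain K where "compact K" "K \<subseteq> A" "{V \<in> open_sets. K \<subseteq> V} \<subseteq> U"
      using UN.IH by meson
    with U(1) show ?case
      by (meson Union_upper subset_trans)
  qed auto
  with that show ?thesis
    by meson
qed

lemma not_second_countable_compact_open_topology:
  "\<not> second_countable (compact_open_topology :: baire set topology)"
proof (rule not_second_countable_open_sets)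
  fix x :: baire
  \<comment> \<open>Singletons are compact, so the open sets containing a given point form a
    generating set.\<close>
  have "{A \<in> open_sets. {x} \<subseteq> A} \<in> {{A \<in> open_sets. K \<subseteq> A} |K. compact K}"
    by (intro CollectI exI[of _ "{x}"]) simp
  then have "openin compact_open_topology {A \<in> open_sets. {x} \<subseteq> A}"
    unfolding compact_open_topology_def by (rule topology_generated_by_Basis)
  then show "openin compact_open_topology {A \<in> open_sets. x \<in> A}"
    by simp
next
  fix U :: "baire set set" and n
  assume "openin compact_open_topology U" "UNIV \<in> U"
  then obtain K where K: "compact K" "{V \<in> open_sets. K \<subseteq> V} \<subseteq> U"
    by (rule compact_open_neighbourhood)
  \<comment> \<open>A compact set is bounded in every coordinate: finitely many of these increasing
    open sets cover \<open>K\<close>, hence a single one does.\<close>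
  have "open {x :: baire. x n \<le> i}" for i
    by (rule open_coordinate)
  moreover have "K \<subseteq> (\<Union>i. {x. x n \<le> i})"
    by auto
  ultimately obtain C where C: "finite C" "K \<subseteq> (\<Union>i\<in>C. {x. x n \<le> i})"
    using compactE_image[OF K(1), of UNIV "\<lambda>i. {x. x n \<le> i}"] by metis
  obtain j where "\<And>i. i \<in> C \<Longrightarrow> i \<le> j"
    using C(1) unfolding finite_nat_set_iff_bounded_le by metis
  with C(2) have "x n \<le> j" if "x \<in> K" for x
    using that by (blast intro: order_trans)
  then have "{x. x n \<le> j} \<in> {V \<in> open_sets. K \<subseteq> V}"
    using open_coordinate by (auto simp: open_sets_def)
  with K(2) show "\<exists>j. {x. x n \<le> j} \<in> U"
    by blast
qed

theorem theorem8p11: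
  fixes B :: "nat \<Rightarrow> baire set" and \<pi> :: "baire \<Rightarrow> baire set"
  assumes "topological_basis (range B)"
    and "B 0 = {}"
    and "\<And>a. \<pi> a = (\<Union>n. B (a n))"
  shows "kernel_code \<pi> \<in> coanalytic_sets
    \<and> wadge_complete coanalytic_sets (\<pi> -` {UNIV})
    \<and> \<not> second_countable (scott_topology (open_sets :: baire set set))
    \<and> \<not> second_countable (compact_open_topology :: baire set topology)"
proof (intro conjI)
  have "open (B n)" for n
    using topological_basis_open[OF assms(1)] by blast
  then show "kernel_code \<pi> \<in> coanalytic_sets"
    using assms(3) by (rule coanalytic_kernel_code)
  show "wadge_complete coanalytic_sets (\<pi> -` {UNIV})"
    using assms by (rule wadge_complete_code_UNIV)
qed (rule not_second_countable_scott_topology not_second_countable_compact_open_topology)+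

end
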